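(* Let $a,b$ be coprime positive integers. Then the identity $$\frac{1}{[a+b]_q}\genfrac{[}{]}{0pt}{}{a+b}{a,b}_q=\sum_{\mu\in \mathrm{D}(a,b)}q^{|\mu|+h^+_{b,a}(\mu)}$$ holds for this choice of $a,b$ if and only if the identities $$\genfrac{[}{]}{0pt}{}{a+b}{a,b}_q=\sum_{\mu\in \mathrm{R}(a,b)}q^{|\mu|+\mathsf{ml}_{b,a}(\mu)+h^+_{b,a}(\mu)}=\sum_{\mu\in \mathrm{R}(a,b)}q^{|\mu|+\mathsf{ml}_{b,a}(\mu)+h^-_{b,a}(\mu)}$$ hold for this choice of $a,b$.
   Context: $q$ is a formal variable, $[n]_q=1+q+\cdots+q^{n-1}$, $[n]!_q=\prod_{j=1}^n[j]_q$, and $\genfrac{[}{]}{0pt}{}{a+b}{a,b}_q=\frac{[a+b]!_q}{[a]!_q[b]!_q}$. $\mathrm{R}(a,b)$ is the set of sequences of integers $\mu=(\mu_1,\ldots,\mu_a)$ with $b\ge\mu_1\ge\cdots\ge\mu_a\ge0$ (partitions whose diagram fits in the box with corners $(0,0),(b,0),(b,a),(0,a)$). The diagram of $\mu$ is placed in the box left-justified with the first row on top: row $j$ (the $j$-th row from the top) consists of the unit cells with $a-j\le y\le a-j+1$ and $0\le x\le\mu_j$. $|\mu|=\mu_1+\cdots+\mu_a$ is the number of cells. $\mathrm{D}(a,b)$ is the subset of those $\mu\in \mathrm{R}(a,b)$ with $\mu_j\le b(a-j)/a$ for all $j$ (diagram contained in the triangle with vertices $(0,0),(0,a),(b,a)$).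 For a cell $c$ in the diagram of $\mu$, $\mathsf{arm}(c)$ is the number of cells of the diagram in the same row to the right of $c$, and $\mathsf{leg}(c)$ is the number of cells of the diagram in the same column below $c$. $h^+_{b,a}(\mu)$ is the number of cells $c$ of $\mu$ with $-a<a\cdot\mathsf{arm}(c)-b\cdot\mathsf{leg}(c)\le b$, and $h^-_{b,a}(\mu)$ is the number of cells $c$ of $\mu$ with $-a\le a\cdot\mathsf{arm}(c)-b\cdot\mathsf{leg}(c)<b$. The frontier of $\mu\in\mathrm{R}(a,b)$ is the lattice path from $(0,0)$ to $(b,a)$ with unit north and east steps along the boundary of the diagram of $\mu$ (so the diagram consists of the cells of the box above and to the left of the path). The level of a lattice point $(x,y)$ is $by-ax$. $\mathsf{ml}_{b,a}(\mu)$ is the minimum level among the lattice points on the frontier of $\mu$. *)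

theory Defs
  imports Complex_Main "HOL-Computational_Algebra.Fraction_Field"
    "HOL-Computational_Algebra.Polynomial"
begin

text \<open>Identities in the formal variable are identities in the field of rational functions
  over the rationals. Division and negative exponents are therefore meaningful.\<close>

definition qvar :: "rat poly fract" where
  "qvar = Fraction_Field.Fract [:0, 1:] 1"

definition qint :: "nat \<Rightarrow> rat poly fract" where
  "qint n = (\<Sum>i<n. qvar ^ i)"

definition qfact :: "nat \<Rightarrow> rat poly fract" where
  "qfact n = (\<Prod>j=1..n. qint j)"

definition qbinom :: "nat \<Rightarrow> nat \<Rightarrow> rat poly fract" where
  "qbinom a b = qfact (a + b) / (qfact a * qfact b)"

text \<open>A partition is the list of its parts, zeros included, so that its length is the height
  of the box.  Parts are numbered from 1.\<close>

definition part :: "nat list \<Rightarrow> nat \<Rightarrow> nat" where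
  "part \<mu> j = \<mu> ! (j - 1)"

definition box_partitions :: "nat \<Rightarrow> nat \<Rightarrow> nat list set" where
  "box_partitions a b = {\<mu>. length \<mu> = a \<and> sorted_wrt (\<ge>) \<mu> \<and> (\<forall>m\<in>set \<mu>. m \<le> b)}"

definition triangle_partitions :: "nat \<Rightarrow> nat \<Rightarrow> nat list set" where
  "triangle_partitions a b = {\<mu> \<in> box_partitions a b.
     \<forall>j\<in>{1..a}. real (part \<mu> j) \<le> real b * (real a - real j) / real a}"

text \<open>A unit cell is represented by its lower left corner \<open>(x, y)\<close>.\<close>

definition cells :: "nat list \<Rightarrow> (nat \<times> nat) set" where
  "cells \<mu> = {(x, y). \<exists>j\<in>{1..length \<mu>}. y = length \<mu> - j \<and> x < part \<mu> j}"

definition arm :: "nat list \<Rightarrow> nat \<times> nat \<Rightarrow> nat" where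
  "arm \<mu> c = card {(x, y) \<in> cells \<mu>. y = snd c \<and> x > fst c}"

definition leg :: "nat list \<Rightarrow> nat \<times> nat \<Rightarrow> nat" where
  "leg \<mu> c = card {(x, y) \<in> cells \<mu>. x = fst c \<and> y < snd c}"

definition hplus :: "nat \<Rightarrow> nat \<Rightarrow> nat list \<Rightarrow> nat" where
  "hplus b a \<mu> = card {c \<in> cells \<mu>.
     - int a < int a * int (arm \<mu> c) - int b * int (leg \<mu> c) \<and>
     int a * int (arm \<mu> c) - int b * int (leg \<mu> c) \<le> int b}"

definition hminus :: "nat \<Rightarrow> nat \<Rightarrow> nat list \<Rightarrow> nat" where
  "hminus b a \<mu> = card {c \<in> cells \<mu>.
     - int a \<le> int a * int (arm \<mu> c) - int b * int (leg \<mu> c) \<and>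
     int a * int (arm \<mu> c) - int b * int (leg \<mu> c) < int b}"

text \<open>\<open>ne_path x y zs\<close> lists the lattice points of the path that starts at \<open>(x, y)\<close>, goes east
  to abscissa \<open>z\<close> for each \<open>z\<close> in \<open>zs\<close> in turn, and takes one north step between consecutive
  elements of \<open>zs\<close>.  For the frontier the abscissas are the parts from the bottom row to
  the top row, followed by the width \<open>b\<close> of the box.\<close>

primrec ne_path :: "nat \<Rightarrow> nat \<Rightarrow> nat list \<Rightarrow> (nat \<times> nat) list" where
  "ne_path x y [] = []"
| "ne_path x y (z # zs) = map (\<lambda>i. (i, y)) [x..<Suc z] @ ne_path z (Suc y) zs"

definition frontier :: "nat \<Rightarrow> nat list \<Rightarrow> (nat \<times> nat) list" where
  "frontier b \<mu> = ne_path 0 0 (rev \<mu> @ [b])"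

definition level :: "nat \<Rightarrow> nat \<Rightarrow> nat \<times> nat \<Rightarrow> int" where
  "level b a p = int b * int (snd p) - int a * int (fst p)"

definition ml :: "nat \<Rightarrow> nat \<Rightarrow> nat list \<Rightarrow> int" where
  "ml b a \<mu> = Min (level b a ` set (frontier b \<mu>))"

text \<open>The sums over partitions are finite, and \<^const>\<open>frontier\<close> is the lattice path from
  \<open>(0, 0)\<close> to \<open>(b, a)\<close> that has exactly the cells of the diagram above and to its left.\<close>

lemma finite_box_partitions: "finite (box_partitions a b)"
proof (rule finite_subset)
  show "box_partitions a b \<subseteq> {xs. set xs \<subseteq> {..b} \<and> length xs = a}"
    by (auto simp: box_partitions_def)
qed (simp add: finite_lists_length_eq)

lemma hd_ne_path: "x \<le> z \<Longrightarrow> ne_path x y (z # zs) \<noteq> [] \<and> hd (ne_path x y (z # zs)) = (x, y)"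
  by (simp add: hd_append hd_map del: upt_Suc)

lemma last_ne_path:
  assumes "sorted (x # zs)" "zs \<noteq> []"
  shows "last (ne_path x y zs) = (last zs, y + length zs - 1)"
  using assms
proof (induction zs arbitrary: x y)
  case (Cons z zs)
  show ?case
  proof (cases zs)
    case Nil
    then show ?thesis using Cons.prems by simp
  next
    case (Cons w ws)
    then have "ne_path z (Suc y) zs \<noteq> []"
      using Cons.prems hd_ne_path[of z w "Suc y" ws] by simp
    then show ?thesis
      using Cons Cons.prems Cons.IH[of z "Suc y"] by (simp del: upt_Suc)
  qed
qed simp

lemma successively_ne_path:
  assumes "sorted (x # zs)"
  shows "successively (\<lambda>(u, v) p. p = (Suc u, v) \<or> p = (u, Suc v)) (ne_path x y zs)"
  using assms
proof (induction zs arbitrary: x y)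
  case (Cons z zs)
  have run: "successively (\<lambda>(u, v) p. p = (Suc u, v) \<or> p = (u, Suc v))
      (map (\<lambda>i. (i, y)) [x..<Suc z])"
    by (auto simp: successively_conv_nth simp del: upt_Suc)
  have last: "last (map (\<lambda>i. (i, y)) [x..<Suc z]) = (z, y)"
    using Cons.prems by simp
  have hd: "ne_path z (Suc y) zs \<noteq> [] \<Longrightarrow> hd (ne_path z (Suc y) zs) = (z, Suc y)"
    using Cons.prems hd_ne_path by (cases zs) auto
  show ?case
    using run last hd Cons.IH[of z "Suc y"] Cons.prems
    by (auto simp: successively_append_iff simp del: upt_Suc)
qed simp

lemma set_ne_path:
  "(u, v) \<in> set (ne_path x y zs) \<longleftrightarrow>
     (\<exists>k<length zs. v = y + k \<and> (x # zs) ! k \<le> u \<and> u \<le> zs ! k)"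
proof (induction zs arbitrary: x y)
  case (Cons z zs)
  have "(\<exists>k<length (z # zs). v = y + k \<and> (x # z # zs) ! k \<le> u \<and> u \<le> (z # zs) ! k) \<longleftrightarrow>
      (v = y \<and> x \<le> u \<and> u \<le> z) \<or>
      (\<exists>k<length zs. v = Suc y + k \<and> (z # zs) ! k \<le> u \<and> u \<le> zs ! k)"
    by (simp only: list.size add_Suc_right add_0_right Ex_less_Suc2) simp
  then show ?case
    by (auto simp: Cons.IH simp del: upt_Suc)
qed simp

lemma sorted_frontier:
  assumes "\<mu> \<in> box_partitions a b"
  shows "sorted (0 # rev \<mu> @ [b])"
  using assms by (auto simp: box_partitions_def sorted_append sorted_wrt_rev)

lemma frontier_path:
  assumes "\<mu> \<in> box_partitions a b"
  shows "hd (frontier b \<mu>) = (0, 0)" "last (frontier b \<mu>) = (b, a)"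
    "successively (\<lambda>(u, v) p. p = (Suc u, v) \<or> p = (u, Suc v)) (frontier b \<mu>)"
proof -
  show "hd (frontier b \<mu>) = (0, 0)"
    using hd_ne_path by (cases "rev \<mu> @ [b]") (auto simp: frontier_def simp del: upt_Suc)
  show "last (frontier b \<mu>) = (b, a)"
    using last_ne_path[OF sorted_frontier[OF assms], of 0] assms
    by (simp add: frontier_def box_partitions_def)
  show "successively (\<lambda>(u, v) p. p = (Suc u, v) \<or> p = (u, Suc v)) (frontier b \<mu>)"
    unfolding frontier_def using successively_ne_path[OF sorted_frontier[OF assms]] .
qed

lemma cells_above_frontier:
  assumes "\<mu> \<in> box_partitions a b"
  shows "cells \<mu> = {(x, y). x < b \<and> y < a \<and> (\<exists>(u, v)\<in>set (frontier b \<mu>). Suc x \<le> u \<and> v \<le> y)}"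
proof -
  let ?zs = "rev \<mu> @ [b]"
  have len: "length \<mu> = a" and le: "\<forall>m\<in>set \<mu>. m \<le> b"
    using assms by (auto simp: box_partitions_def)
  have srt: "sorted (0 # ?zs)" using sorted_frontier[OF assms] .
  have zs: "?zs ! y = \<mu> ! (a - Suc y)" if "y < a" for y
    using that len by (simp add: nth_append rev_nth)
  have cell: "(x, y) \<in> cells \<mu> \<longleftrightarrow> y < a \<and> x < ?zs ! y" for x y
  proof -
    have "(x, y) \<in> cells \<mu> \<longleftrightarrow> y < a \<and> x < \<mu> ! (a - Suc y)"
    proof
      assume "(x, y) \<in> cells \<mu>"
      then obtain j where "j \<in> {1..a}" "y = a - j" "x < \<mu> ! (j - 1)"
        by (auto simp: cells_def part_def len)
      moreover from this have "a - Suc y = j - 1" by auto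
      ultimately show "y < a \<and> x < \<mu> ! (a - Suc y)" by auto
    next
      assume "y < a \<and> x < \<mu> ! (a - Suc y)"
      then show "(x, y) \<in> cells \<mu>"
        by (auto simp: cells_def part_def len intro!: bexI[of _ "a - y"])
    qed
    then show ?thesis using zs by auto
  qed
  have front: "(\<exists>(u, v)\<in>set (frontier b \<mu>). Suc x \<le> u \<and> v \<le> y) \<longleftrightarrow> x < ?zs ! y"
    if "y < a" for x y
  proof
    assume "\<exists>(u, v)\<in>set (frontier b \<mu>). Suc x \<le> u \<and> v \<le> y"
    then obtain u v where uv: "(u, v) \<in> set (frontier b \<mu>)" "Suc x \<le> u" "v \<le> y" by auto
    then have "u \<le> ?zs ! v" by (auto simp: frontier_def set_ne_path)
    also have "\<dots> \<le> ?zs ! y"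
      using srt uv(3) \<open>y < a\<close> len by (auto intro!: sorted_nth_mono)
    finally show "x < ?zs ! y" using uv(2) by simp
  next
    assume *: "x < ?zs ! y"
    have "(0 # ?zs) ! y \<le> (0 # ?zs) ! Suc y"
      using srt \<open>y < a\<close> len by (intro sorted_nth_mono) auto
    then have "(?zs ! y, y) \<in> set (frontier b \<mu>)"
      using \<open>y < a\<close> len by (auto simp: frontier_def set_ne_path)
    then show "\<exists>(u, v)\<in>set (frontier b \<mu>). Suc x \<le> u \<and> v \<le> y"
      using * by (auto intro!: bexI[of _ "(?zs ! y, y)"])
  qed
  have "x < b" if "y < a" "x < ?zs ! y" for x y
  proof -
    have "\<mu> ! (a - Suc y) \<in> set \<mu>" using that len by simp
    then show ?thesis using le that zs by fastforce
  qed
  then have "(x, y) \<in> cells \<mu> \<longleftrightarrow>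
      x < b \<and> y < a \<and> (\<exists>(u, v)\<in>set (frontier b \<mu>). Suc x \<le> u \<and> v \<le> y)" for x y
    using cell front by metis
  then show ?thesis by (simp add: set_eq_iff)
qed

end

(* Read the frontier of a partition cyclically, as a word of a north and b east steps. A cell is a
   pair (E, N) of an east step that precedes a north step, and a arm - b leg + a is the difference
   of the levels at which E and N start. So |mu| counts the pairs (E, N) with E before N, and h^+
   and h^- count those among them whose level difference lies in (0, a+b] and in [0, a+b)
   respectively. Since a and b are coprime, the a+b levels on a path are distinct modulo a+b; hence
   h^+ = h^-, and the second identity of the right-hand side is automatic.

   Moving the first step of a word to its end shifts all levels by a constant. Comparing the three
   statistics before and after shows that |mu| + ml + h^+ changes exactly as the number of vertices
   of negative level does. In a cyclic orbit this number takes each of the values 0, ..., a+b-1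
   once, and it is 0 for exactly one word, whose partition lies in the triangle and has ml = 0. So
   the sum over the box is [a+b]_q times the sum over the triangle. *)

theory Submission
  imports Defs
begin

section \<open>Words of north and east steps, and step counts along them\<close>

definition north :: "(nat \<Rightarrow> bool) \<Rightarrow> nat \<Rightarrow> nat" where
  "north W i = (\<Sum>k<i. of_bool (W k))"

definition east :: "(nat \<Rightarrow> bool) \<Rightarrow> nat \<Rightarrow> nat" where
  "east W i = (\<Sum>k<i. of_bool (\<not> W k))"

text \<open>A word is extended to an infinite periodic sequence, \<^const>\<open>True\<close> standing for a north step, so
  that cyclic shifts of the word are shifts of the sequence.\<close>

definition words :: "nat \<Rightarrow> nat \<Rightarrow> (nat \<Rightarrow> bool) set" where
  "words a b = {W. (\<forall>i. W (i + (a + b)) = W i) \<and> north W (a + b) = a}"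

definition lev :: "nat \<Rightarrow> nat \<Rightarrow> (nat \<Rightarrow> bool) \<Rightarrow> nat \<Rightarrow> int" where
  "lev a b W i = level b a (east W i, north W i)"

text \<open>A row of the diagram ends at its north step, so its length is the number of east steps
  before that step. North steps come bottom row first, parts top row first, whence
  \<open>rev\<close>.\<close>

definition partition_of :: "nat \<Rightarrow> (nat \<Rightarrow> bool) \<Rightarrow> nat list" where
  "partition_of n W = rev (map (east W) (filter W [0..<n]))"

definition inversions :: "nat \<Rightarrow> (nat \<Rightarrow> bool) \<Rightarrow> (nat \<times> nat) set" where
  "inversions n W = {(i, j). i < j \<and> j < n \<and> \<not> W i \<and> W j}"

lemma north_0 [simp]: "north W 0 = 0"
  and north_Suc [simp]: "north W (Suc i) = north W i + of_bool (W i)"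
  and east_0 [simp]: "east W 0 = 0"
  and east_Suc [simp]: "east W (Suc i) = east W i + of_bool (\<not> W i)"
  by (simp_all add: north_def east_def)

lemma east_add_north: "east W i + north W i = i"
  by (induction i) auto

lemma north_mono: "i \<le> j \<Longrightarrow> north W i \<le> north W j"
  by (induction j rule: dec_induct) auto

lemma east_mono: "i \<le> j \<Longrightarrow> east W i \<le> east W j"
  by (induction j rule: dec_induct) auto

lemma north_less: "W i \<Longrightarrow> i < j \<Longrightarrow> north W i < north W j"
  using north_mono[of "Suc i" j W] by simp

lemma east_less: "\<not> W i \<Longrightarrow> i < j \<Longrightarrow> east W i < east W j"
  using east_mono[of "Suc i" j W] by simp

lemma north_inj: "W i \<Longrightarrow> W j \<Longrightarrow> north W i = north W j \<Longrightarrow> i = j"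
  using north_less[of W i j] north_less[of W j i] by (cases i j rule: linorder_cases) auto

lemma east_inj: "\<not> W i \<Longrightarrow> \<not> W j \<Longrightarrow> east W i = east W j \<Longrightarrow> i = j"
  using east_less[of W i j] east_less[of W j i] by (cases i j rule: linorder_cases) auto

text \<open>A discrete intermediate value property: heights grow by at most one per step, so the
  path leaves every height below its final one by a north step.\<close>

lemma ex_north_step: "y < north W n \<Longrightarrow> \<exists>j<n. W j \<and> north W j = y"
proof (induction n)
  case (Suc n)
  show ?case
  proof (cases "y < north W n")
    case True
    then show ?thesis using Suc.IH less_SucI by blast
  next
    case False
    then have "W n" "north W n = y" using Suc.prems by (cases "W n"; simp)+
    then show ?thesis by blast
  qed
qed simp

lemma ex_east_step: "x < east W n \<Longrightarrow> \<exists>i<n. \<not> W i \<and> east W i = x"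
proof (induction n)
  case (Suc n)
  show ?case
  proof (cases "x < east W n")
    case True
    then show ?thesis using Suc.IH less_SucI by blast
  next
    case False
    then have "\<not> W n" "east W n = x" using Suc.prems by (cases "W n"; simp)+
    then show ?thesis by blast
  qed
qed simp

lemma less_iff_east_less:
  assumes "\<not> W i" "W j"
  shows "i < j \<longleftrightarrow> east W i < east W j"
  using east_less[of W i j] assms east_mono[of j i W] by (cases "i < j") auto

lemma less_iff_north_le:
  assumes "\<not> W i" "W j"
  shows "i < j \<longleftrightarrow> north W i \<le> north W j"
proof -
  have "i \<noteq> j" using assms by auto
  then show ?thesis
    using north_less[of W j i] assms north_mono[of i j W] by (cases "i < j") auto
qed

section \<open>The partition of a word; cells, arms and legs as inversions\<close>

lemma length_filter_north: "length (filter W [0..<i]) = north W i"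
  by (induction i) auto

lemma nth_filter_north:
  assumes "W j" "j < n"
  shows "filter W [0..<n] ! north W j = j"
proof -
  have "[0..<n] = [0..<j] @ j # [Suc j..<n]"
    using assms upt_add_eq_append[of 0 j "n - j"] upt_conv_Cons[of j n] by simp
  then show ?thesis
    using assms by (simp add: nth_append length_filter_north del: upt_Suc)
qed

lemma length_partition_of [simp]: "length (partition_of n W) = north W n"
  by (simp add: partition_of_def length_filter_north)

lemma rev_partition_of_nth:
  assumes "W j" "j < n"
  shows "rev (partition_of n W) ! north W j = east W j"
  using assms nth_filter_north[of W j n] north_less[of W j n]
  by (simp add: partition_of_def length_filter_north)

lemma part_partition_of:
  assumes "W j" "j < n"
  shows "part (partition_of n W) (north W n - north W j) = east W j"
  using assms nth_filter_north[of W j n] north_less[of W j n]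
  by (simp add: partition_of_def length_filter_north part_def rev_nth)

lemma cells_partition_of:
  "cells (partition_of n W) = {(x, y). \<exists>j<n. W j \<and> north W j = y \<and> x < east W j}"
proof (rule set_eqI, clarify)
  fix x y
  show "(x, y) \<in> cells (partition_of n W) \<longleftrightarrow>
    (x, y) \<in> {(x, y). \<exists>j<n. W j \<and> north W j = y \<and> x < east W j}"
  proof
    assume "(x, y) \<in> cells (partition_of n W)"
    then obtain k where k: "1 \<le> k" "k \<le> north W n" "y = north W n - k"
        "x < part (partition_of n W) k"
      by (auto simp: cells_def)
    then obtain j where j: "j < n" "W j" "north W j = y"
      using ex_north_step[of y W n] by auto
    have "k = north W n - north W j" using k j by auto
    then show "(x, y) \<in> {(x, y). \<exists>j<n. W j \<and> north W j = y \<and> x < east W j}"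
      using j k part_partition_of[of W j n] by auto
  next
    assume "(x, y) \<in> {(x, y). \<exists>j<n. W j \<and> north W j = y \<and> x < east W j}"
    then obtain j where j: "j < n" "W j" "north W j = y" "x < east W j" by auto
    then show "(x, y) \<in> cells (partition_of n W)"
      using part_partition_of[of W j n] north_less[of W j n]
      by (auto simp: cells_def intro!: bexI[of _ "north W n - north W j"])
  qed
qed

text \<open>Each column of the box contains exactly one east step and each row exactly one north
  step. The cell where they meet is left of the path precisely when the east step comes
  first.\<close>

lemma bij_betw_inversions_cells:
  "bij_betw (\<lambda>(i, j). (east W i, north W j)) (inversions n W) (cells (partition_of n W))"
  unfolding bij_betw_def
proof
  show "inj_on (\<lambda>(i, j). (east W i, north W j)) (inversions n W)"
    using east_inj[of W] north_inj[of W] by (auto simp: inj_on_def inversions_def)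
  show "(\<lambda>(i, j). (east W i, north W j)) ` inversions n W = cells (partition_of n W)"
  proof
    show "(\<lambda>(i, j). (east W i, north W j)) ` inversions n W \<subseteq> cells (partition_of n W)"
      using east_less[of W] by (auto simp: cells_partition_of inversions_def)
    show "cells (partition_of n W) \<subseteq> (\<lambda>(i, j). (east W i, north W j)) ` inversions n W"
    proof (clarsimp simp: cells_partition_of)
      fix x j assume j: "j < n" "W j" "x < east W j"
      then obtain i where "i < j" "\<not> W i" "east W i = x" using ex_east_step by blast
      then show "(x, north W j) \<in> (\<lambda>(i, j). (east W i, north W j)) ` inversions n W"
        using j by (auto simp: inversions_def image_iff intro!: bexI[of _ "(i, j)"])
    qed
  qed
qed

text \<open>The row of the north step \<open>j\<close> ends at abscissa \<open>east W j\<close>. The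
  \<open>- 1\<close> is the cell itself, which its arm does not count.\<close>

lemma arm_partition_of:
  assumes "(i, j) \<in> inversions n W"
  shows "int (arm (partition_of n W) (east W i, north W j)) = int (east W j) - int (east W i) - 1"
proof -
  have ij: "i < j" "j < n" "\<not> W i" "W j" using assms by (auto simp: inversions_def)
  have "{(x, y) \<in> cells (partition_of n W). y = north W j \<and> x > east W i} =
      (\<lambda>x. (x, north W j)) ` {east W i<..<east W j}"
    using ij north_inj[of W j] by (fastforce simp: cells_partition_of image_iff)
  then have "arm (partition_of n W) (east W i, north W j) = card {east W i<..<east W j}"
    by (simp add: arm_def card_image inj_on_def)
  then show ?thesis using east_less[of W i j] ij by simp
qed

text \<open>The path crosses the column of \<open>i\<close> at height \<open>north W i\<close>, so
  the cells of that column start there; those below height \<open>north W j\<close> form the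
  leg.\<close>

lemma leg_partition_of:
  assumes "(i, j) \<in> inversions n W"
  shows "int (leg (partition_of n W) (east W i, north W j)) = int (north W j) - int (north W i)"
proof -
  have ij: "i < j" "j < n" "\<not> W i" "W j" using assms by (auto simp: inversions_def)
  have "(x = east W i \<and> (x, y) \<in> cells (partition_of n W) \<and> y < north W j) \<longleftrightarrow>
      (x = east W i \<and> y \<in> {north W i..<north W j})" for x y
  proof
    assume *: "x = east W i \<and> y \<in> {north W i..<north W j}"
    then obtain k where k: "k < j" "W k" "north W k = y" using ex_north_step[of y W j] by auto
    then have "i < k" using less_iff_north_le[of W i k] ij(3) k(2) * by simp
    then show "x = east W i \<and> (x, y) \<in> cells (partition_of n W) \<and> y < north W j"
      using k * ij east_less[of W i k]
      by (auto simp: cells_partition_of intro!: exI[of _ k])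
  next
    assume *: "x = east W i \<and> (x, y) \<in> cells (partition_of n W) \<and> y < north W j"
    then obtain k where k: "k < n" "W k" "north W k = y" "east W i < east W k"
      by (auto simp: cells_partition_of)
    then show "x = east W i \<and> y \<in> {north W i..<north W j}"
      using less_iff_north_le[of W i k] ij(3) k(2) less_iff_east_less[of W i k] * by auto
  qed
  then have "{(x, y) \<in> cells (partition_of n W). x = east W i \<and> y < north W j} =
      Pair (east W i) ` {north W i..<north W j}"
    by (simp add: set_eq_iff image_iff) metis
  then have "leg (partition_of n W) (east W i, north W j) = card {north W i..<north W j}"
    by (simp add: leg_def card_image inj_on_def)
  then show ?thesis using north_mono[of i j W] ij by simp
qed

text \<open>The term \<open>- int a\<close> stems from the cell missing in its own arm. It turns the
  asymmetric bounds \<open>- a\<close> and \<open>b\<close> of \<open>hplus\<close> and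
  \<open>hminus\<close> into \<open>0\<close> and \<open>a + b\<close>.\<close>

lemma arm_leg_lev:
  assumes "(i, j) \<in> inversions n W"
  shows "int a * int (arm (partition_of n W) (east W i, north W j))
       - int b * int (leg (partition_of n W) (east W i, north W j))
       = lev a b W i - lev a b W j - int a"
  unfolding arm_partition_of[OF assms] leg_partition_of[OF assms]
  by (simp add: lev_def level_def algebra_simps)

lemma card_cells_lev:
  "card {c \<in> cells (partition_of n W). P (int a * int (arm (partition_of n W) c)
       - int b * int (leg (partition_of n W) c))}
   = card {(i, j) \<in> inversions n W. P (lev a b W i - lev a b W j - int a)}"
proof -
  let ?f = "\<lambda>(i, j). (east W i, north W j)"
  let ?A = "{(i, j) \<in> inversions n W. P (lev a b W i - lev a b W j - int a)}"
  have inj: "inj_on ?f (inversions n W)" and im: "?f ` inversions n W = cells (partition_of n W)"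
    using bij_betw_inversions_cells[of W n] by (auto simp: bij_betw_def)
  have "{c \<in> cells (partition_of n W). P (int a * int (arm (partition_of n W) c)
       - int b * int (leg (partition_of n W) c))} = ?f ` ?A"
    unfolding im[symmetric] by (auto simp: arm_leg_lev)
  moreover have "inj_on ?f ?A" by (rule inj_on_subset[OF inj]) auto
  ultimately show ?thesis by (simp add: card_image)
qed

lemma hplus_partition_of:
  "hplus b a (partition_of n W) = card {(i, j) \<in> inversions n W.
     0 < lev a b W i - lev a b W j \<and> lev a b W i - lev a b W j \<le> int (a + b)}"
  unfolding hplus_def
  by (subst card_cells_lev) (intro arg_cong[where f = card], auto)

lemma hminus_partition_of:
  "hminus b a (partition_of n W) = card {(i, j) \<in> inversions n W.
     0 \<le> lev a b W i - lev a b W j \<and> lev a b W i - lev a b W j < int (a + b)}"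
  unfolding hminus_def
  by (subst card_cells_lev) (intro arg_cong[where f = card], auto)

text \<open>Sums over the triangle \<open>i < j < n\<close> are the form in which
  \<open>sum_triangle_shift\<close> can follow a cyclic shift.\<close>

lemma card_inversions:
  "card {(i, j) \<in> inversions n W. P i j}
   = (\<Sum>j<n. \<Sum>i<j. of_bool (\<not> W i \<and> W j \<and> P i j))"
proof -
  have "{(i, j) \<in> inversions n W. P i j} =
      (\<lambda>(j, i). (i, j)) ` (SIGMA j:{..<n}. {i. i < j \<and> \<not> W i \<and> W j \<and> P i j})"
    by (auto simp: inversions_def image_iff)
  then have "card {(i, j) \<in> inversions n W. P i j}
      = card (SIGMA j:{..<n}. {i. i < j \<and> \<not> W i \<and> W j \<and> P i j})"
    by (simp add: card_image inj_on_def split_def)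
  also have "\<dots> = (\<Sum>j<n. card {i. i < j \<and> \<not> W i \<and> W j \<and> P i j})"
    by (subst card_SigmaI) auto
  also have "\<dots> = (\<Sum>j<n. \<Sum>i<j. of_bool (\<not> W i \<and> W j \<and> P i j))"
  proof (rule sum.cong[OF refl])
    fix j
    have "{i. i < j \<and> \<not> W i \<and> W j \<and> P i j} = {..<j} \<inter> {i. \<not> W i \<and> W j \<and> P i j}" by auto
    then show "card {i. i < j \<and> \<not> W i \<and> W j \<and> P i j}
        = (\<Sum>i<j. of_bool (\<not> W i \<and> W j \<and> P i j))"
      by (simp add: sum_of_bool_eq)
  qed
  finally show ?thesis .
qed

lemma sum_list_partition_of: "sum_list (partition_of n W) = card (inversions n W)"
proof -
  have "sum_list (partition_of n W) = (\<Sum>j<n. if W j then east W j else 0)"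
    by (simp add: partition_of_def sum_list_map_filter' interv_sum_list_conv_sum_set_nat
        atLeast0LessThan)
  also have "\<dots> = (\<Sum>j<n. \<Sum>i<j. of_bool (\<not> W i \<and> W j \<and> True))"
    by (rule sum.cong) (auto simp: east_def)
  finally show ?thesis using card_inversions[of n W "\<lambda>i j. True"] by simp
qed


section \<open>The frontier of a word, and the bijection between words and partitions in the
  box\<close>

lemma words_mod:
  assumes "W \<in> words a b"
  shows "W (i mod (a + b)) = W i"
proof (induction i rule: less_induct)
  case (less i)
  show ?case
  proof (cases "a + b = 0 \<or> i < a + b")
    case False
    then have "W ((i - (a + b)) mod (a + b)) = W (i - (a + b))" by (intro less) auto
    moreover have "W (i - (a + b) + (a + b)) = W (i - (a + b))"
      using assms by (simp only: words_def mem_Collect_eq)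
    ultimately show ?thesis using False by (simp add: le_mod_geq)
  qed auto
qed

lemma words_north: "W \<in> words a b \<Longrightarrow> north W (a + b) = a"
  by (simp add: words_def)

lemma words_east: "W \<in> words a b \<Longrightarrow> east W (a + b) = b"
  using east_add_north[of W "a + b"] words_north[of W a b] by simp

text \<open>\<open>frontier\<close> describes the path row by row, a word step by step. Each
  horizontal run of \<open>ne_path\<close> is matched with the block of vertices at that
  height.\<close>

lemma set_frontier_partition_of:
  assumes W: "W \<in> words a b"
  shows "set (frontier b (partition_of (a + b) W)) = (\<lambda>i. (east W i, north W i)) ` {..a + b}"
proof -
  let ?n = "a + b" and ?r = "rev (partition_of (a + b) W)"
  let ?zs = "?r @ [b]"
  have len: "length ?r = a" using words_north[OF W] by simp
  \<comment> \<open>\<open>q\<close> is the last vertex at height \<open>v\<close>: the start of a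
    north step, or the end of the path if \<open>v = a\<close>.\<close>
  have hi: "\<exists>q\<le>?n. north W q = v \<and> ?zs ! v = east W q \<and> (\<forall>i\<le>?n. north W i \<le> v \<longrightarrow> i \<le> q)"
    if v: "v \<le> a" for v
  proof (cases "v = a")
    case True
    then show ?thesis
      using words_north[OF W] words_east[OF W] len by (intro exI[of _ ?n]) (simp add: nth_append)
  next
    case False
    then obtain j where j: "j < ?n" "W j" "north W j = v"
      using ex_north_step[of v W ?n] v words_north[OF W] by auto
    have "i \<le> j" if "north W i \<le> v" for i
      using north_less[of W j i] j that by force
    then show ?thesis
      using j rev_partition_of_nth[of W j ?n] len v False
      by (intro exI[of _ j]) (auto simp: nth_append)
  qed
  \<comment> \<open>\<open>p\<close> is the first vertex at height \<open>v\<close>: the origin, or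
    the end of a north step.\<close>
  have lo: "\<exists>p. north W p = v \<and> (0 # ?zs) ! v = east W p \<and> (\<forall>i. v \<le> north W i \<longrightarrow> p \<le> i)"
    if v: "v \<le> a" for v
  proof (cases v)
    case 0
    then show ?thesis by (intro exI[of _ 0]) simp
  next
    case (Suc v')
    then obtain j where j: "j < ?n" "W j" "north W j = v'"
      using ex_north_step[of v' W ?n] v words_north[OF W] by auto
    have "Suc j \<le> i" if "v \<le> north W i" for i
      using north_mono[of i j W] j that Suc by (cases "i \<le> j") auto
    then show ?thesis
      using j rev_partition_of_nth[of W j ?n] len v Suc
      by (intro exI[of _ "Suc j"]) (auto simp: nth_append)
  qed
  have "(u, v) \<in> set (frontier b (partition_of ?n W))
      \<longleftrightarrow> (u, v) \<in> (\<lambda>i. (east W i, north W i)) ` {..?n}" (is "?L \<longleftrightarrow> ?R") for u v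
  proof
    assume ?L
    then have v: "v \<le> a" and u: "(0 # ?zs) ! v \<le> u" "u \<le> ?zs ! v"
      using len by (auto simp: frontier_def set_ne_path)
    obtain p where p: "north W p = v" "east W p \<le> u" using lo[OF v] u by auto
    obtain q where q: "north W q = v" "u \<le> east W q" "q \<le> ?n" using hi[OF v] u by auto
    \<comment> \<open>The coordinates of a vertex add up to its index, so \<open>u + v\<close> is
      the only index at which the path can visit \<open>(u, v)\<close>.\<close>
    have pi: "p \<le> u + v" using p east_add_north[of W p] by simp
    have iq: "u + v \<le> q" using q east_add_north[of W q] by simp
    have "north W (u + v) = v" using north_mono[OF pi, of W] north_mono[OF iq, of W] p q by simp
    moreover from this have "east W (u + v) = u" using east_add_north[of W "u + v"] by simp
    ultimately show ?R using iq q by (auto simp: image_iff intro!: bexI[of _ "u + v"])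
  next
    assume ?R
    then obtain i where i: "i \<le> ?n" "u = east W i" "v = north W i" by auto
    have v: "v \<le> a" using i north_mono[of i ?n W] words_north[OF W] by simp
    obtain p where p: "(0 # ?zs) ! v = east W p" "p \<le> i" using lo[OF v] i by auto
    obtain q where q: "?zs ! v = east W q" "i \<le> q" using hi[OF v] i by auto
    show ?L
      using p q v len i east_mono[of p i W] east_mono[of i q W]
      by (auto simp: frontier_def set_ne_path intro!: exI[of _ v])
  qed
  then show ?thesis by auto
qed

lemma ml_partition_of:
  assumes "W \<in> words a b"
  shows "ml b a (partition_of (a + b) W) = Min (lev a b W ` {..a + b})"
  by (simp add: ml_def set_frontier_partition_of[OF assms] image_image lev_def)

lemma bij_betw_partition_of:
  assumes "a > 0"
  shows "bij_betw (partition_of (a + b)) (words a b) (box_partitions a b)"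
  unfolding bij_betw_def
proof
  let ?n = "a + b"
  show "inj_on (partition_of ?n) (words a b)"
  proof (rule inj_onI)
    fix W W' assume W: "W \<in> words a b" and W': "W' \<in> words a b"
      and eq: "partition_of ?n W = partition_of ?n W'"
    \<comment> \<open>Equal partitions have equal frontiers, and the coordinate sum recovers the
      index of each vertex.\<close>
    have *: "north W i = north W' i" if "i \<le> ?n" for i
    proof -
      have "(east W i, north W i) \<in> (\<lambda>i. (east W' i, north W' i)) ` {..?n}"
        unfolding set_frontier_partition_of[OF W', symmetric] eq[symmetric]
        unfolding set_frontier_partition_of[OF W] using that by auto
      then obtain k where k: "east W i = east W' k" "north W i = north W' k" by auto
      then have "i = k" using east_add_north[of W i] east_add_north[of W' k] by simp
      then show ?thesis using k by simp
    qed
    have "W i = W' i" if "i < ?n" for i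
      using *[of i] *[of "Suc i"] that by (cases "W i"; cases "W' i") auto
    then have "W i = W' i" for i
      using words_mod[OF W, of i] words_mod[OF W', of i] assms by (metis add_gr_0 mod_less_divisor)
    then show "W = W'" by auto
  qed
  show "partition_of ?n ` words a b = box_partitions a b"
  proof
    show "partition_of ?n ` words a b \<subseteq> box_partitions a b"
    proof (rule image_subsetI)
      fix W assume W: "W \<in> words a b"
      have "sorted (map (east W) (filter W [0..<?n]))"
        by (rule sorted_map_mono)
          (auto simp: mono_on_def intro: east_mono sorted_wrt_filter)
      moreover have "east W i \<le> b" if "i < ?n" for i
        using that east_mono[of i ?n W] words_east[OF W] by simp
      ultimately show "partition_of ?n W \<in> box_partitions a b"
        using words_north[OF W]
        by (auto simp: box_partitions_def partition_of_def sorted_wrt_rev length_filter_north)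
    qed
    show "box_partitions a b \<subseteq> partition_of ?n ` words a b"
    proof
      fix \<mu> assume mu: "\<mu> \<in> box_partitions a b"
      define r where "r = rev \<mu>"
      have len: "length r = a" and srt: "sorted r" and le: "\<And>y. y < a \<Longrightarrow> r ! y \<le> b"
        using mu by (auto simp: r_def box_partitions_def sorted_wrt_rev)
          (metis length_rev nth_mem set_rev)
      \<comment> \<open>The north step of row \<open>y\<close>, counted from the bottom, is preceded
        by \<open>r ! y\<close> east steps and \<open>y\<close> north steps; \<open>s\<close> lists
        these positions.\<close>
      define s where "s = map (\<lambda>y. r ! y + y) [0..<a]"
      define W where "W i = (i mod ?n \<in> set s)" for i
      have less: "r ! x + x < r ! y + y" if "x < y" "y < a" for x y
        using sorted_nth_mono[OF srt, of x y] that len by simp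
      have "sorted_wrt (<) s"
        using less by (simp add: s_def sorted_wrt_iff_nth_less)
      then have s: "sorted s" "distinct s" by (simp_all add: strict_sorted_iff)
      have bound: "i < ?n" if "i \<in> set s" for i using that le by (force simp: s_def)
      have filt: "filter W [0..<?n] = s"
      proof (rule sorted_distinct_set_unique)
        show "sorted (filter W [0..<?n])" by (simp add: sorted_wrt_filter)
        show "set (filter W [0..<?n]) = set s" using bound by (auto simp: W_def)
      qed (use s in auto)
      then have north_n: "north W ?n = a" by (metis length_filter_north length_map length_upt
          minus_nat.diff_0 s_def)
      then have "W \<in> words a b" by (simp add: words_def W_def)
      moreover have "partition_of ?n W = \<mu>"
      proof -
        have "east W (r ! y + y) = r ! y" if y: "y < a" for y
        proof -
          obtain j where j: "j < ?n" "W j" "north W j = y"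
            using ex_north_step[of y W ?n] y north_n by auto
          then have "j = r ! y + y"
            using nth_filter_north[of W j ?n] y by (simp add: filt s_def)
          then show ?thesis using j east_add_north[of W j] by simp
        qed
        then have "map (east W) s = r"
          using len by (auto simp: s_def intro!: nth_equalityI)
        then show ?thesis by (simp add: partition_of_def filt r_def)
      qed
      ultimately show "\<mu> \<in> partition_of ?n ` words a b" by auto
    qed
  qed
qed

section \<open>Levels along a word, and the triangle condition\<close>

lemma lev_0 [simp]: "lev a b W 0 = 0"
  by (simp add: lev_def level_def)

lemma lev_Suc: "lev a b W (Suc i) = lev a b W i + (if W i then int b else - int a)"
  by (simp add: lev_def level_def algebra_simps)

text \<open>In one period the \<open>a\<close> north steps climb by \<open>b\<close> each and the
  \<open>b\<close> east steps descend by \<open>a\<close> each, so the level returns.\<close>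

lemma lev_period:
  assumes "W \<in> words a b"
  shows "lev a b W (i + (a + b)) = lev a b W i"
proof (induction i)
  case 0
  then show ?case using words_north[OF assms] words_east[OF assms] by (simp add: lev_def level_def)
next
  case (Suc i)
  have "W (i + (a + b)) = W i" using assms by (simp only: words_def mem_Collect_eq)
  then show ?case using Suc by (simp add: lev_Suc)
qed

lemma lev_mod:
  assumes "W \<in> words a b"
  shows "lev a b W (i mod (a + b)) = lev a b W i"
proof -
  have "lev a b W (r + k * (a + b)) = lev a b W r" for r k
    using lev_period[OF assms] by (induction k) (simp_all add: add.assoc[symmetric] add.commute[of "a + b"])
  from this[of "i mod (a + b)" "i div (a + b)"] show ?thesis by (simp only: mod_div_mult_eq)
qed

text \<open>The triangle condition on a row says that its north step starts at nonnegative level.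
  All other vertices follow by going backwards from the end, which has level 0: an east step
  descends, so it starts above its endpoint.\<close>

lemma partition_of_triangle_iff:
  assumes W: "W \<in> words a b" and a: "a > 0"
  shows "partition_of (a + b) W \<in> triangle_partitions a b \<longleftrightarrow> (\<forall>i. 0 \<le> lev a b W i)"
proof -
  let ?n = "a + b" and ?\<mu> = "partition_of (a + b) W"
  have box: "?\<mu> \<in> box_partitions a b"
    using bij_betw_partition_of[OF a, of b] W by (auto simp: bij_betw_def)
  have north_step: "real (part ?\<mu> k) \<le> real b * (real a - real k) / real a \<longleftrightarrow> 0 \<le> lev a b W i"
    if "i < ?n" "W i" "k = a - north W i" for i k
  proof -
    have "part ?\<mu> k = east W i" using part_partition_of[of W i ?n] words_north[OF W] that by simp
    moreover have "real a - real k = real (north W i)"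
      using that north_less[of W i ?n] words_north[OF W] by simp
    ultimately have "real (part ?\<mu> k) \<le> real b * (real a - real k) / real a \<longleftrightarrow>
        real (a * east W i) \<le> real (b * north W i)"
      using a by (simp add: field_simps)
    also have "\<dots> \<longleftrightarrow> int (a * east W i) \<le> int (b * north W i)" by linarith
    finally show ?thesis by (simp add: lev_def level_def)
  qed
  show ?thesis
  proof
    assume "?\<mu> \<in> triangle_partitions a b"
    then have tri: "real (part ?\<mu> k) \<le> real b * (real a - real k) / real a" if "k \<in> {1..a}" for k
      using that by (auto simp: triangle_partitions_def)
    have "0 \<le> lev a b W i" if "i \<le> ?n" for i
      using that
    proof (induction i rule: inc_induct)
      case base
      then show ?case using lev_period[OF W, of 0] by simp
    next
      case (step i)
      show ?case
      proof (cases "W i")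
        case True
        have "a - north W i \<in> {1..a}"
          using north_less[of W i ?n] True step words_north[OF W] by auto
        then show ?thesis using north_step[of i] tri True step by blast
      next
        case False
        then show ?thesis using step by (simp add: lev_Suc)
      qed
    qed
    then have "0 \<le> lev a b W (i mod ?n)" for i using a by (simp add: less_imp_le)
    then show "\<forall>i. 0 \<le> lev a b W i" using lev_mod[OF W] by simp
  next
    assume nonneg: "\<forall>i. 0 \<le> lev a b W i"
    have "real (part ?\<mu> k) \<le> real b * (real a - real k) / real a" if k: "k \<in> {1..a}" for k
    proof -
      obtain i where "i < ?n" "W i" "north W i = a - k"
        using ex_north_step[of "a - k" W ?n] k words_north[OF W] by auto
      then show ?thesis using north_step[of i k] nonneg k by auto
    qed
    then show "?\<mu> \<in> triangle_partitions a b" using box by (simp add: triangle_partitions_def)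
  qed
qed


section \<open>Cyclic shifts, and distinctness of levels modulo \<open>a + b\<close>\<close>

definition shift :: "nat \<Rightarrow> (nat \<Rightarrow> bool) \<Rightarrow> nat \<Rightarrow> bool" where
  "shift k W = (\<lambda>i. W (i + k))"

lemma shift_shift: "shift k (shift l W) = shift (k + l) W"
  by (simp add: shift_def add.assoc)

lemma north_shift: "north (shift k W) i + north W k = north W (i + k)"
  by (induction i) (auto simp: shift_def)

lemma lev_shift: "lev a b (shift k W) i = lev a b W (i + k) - lev a b W k"
  by (induction i) (auto simp: lev_Suc shift_def)

lemma shift_in_words:
  assumes "W \<in> words a b"
  shows "shift k W \<in> words a b"
proof -
  have per: "W (i + (a + b)) = W i" for i
    using assms by (simp only: words_def mem_Collect_eq)
  have "W (i + (a + b) + k) = W (i + k)" for i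
    using per[of "i + k"] by (simp add: add_ac)
  moreover have "north W (a + b + k) = a + north W k" for k
  proof (induction k)
    case (Suc k)
    then show ?case using per[of k] by (simp add: add_ac)
  qed (simp add: words_north[OF assms])
  then have "north (shift k W) (a + b) = a"
    using north_shift[of k W "a + b"] by simp
  ultimately show ?thesis by (simp only: words_def shift_def mem_Collect_eq simp_thms)
qed

lemma shift_eq_self:
  assumes "W \<in> words a b" "k mod (a + b) = 0"
  shows "shift k W = W"
proof
  fix i
  have "(i + k) mod (a + b) = i mod (a + b)"
    using assms(2) by (metis add.right_neutral mod_add_right_eq)
  then show "shift k W i = W i"
    using words_mod[OF assms(1), of "i + k"] words_mod[OF assms(1), of i] by (simp add: shift_def)
qed

text \<open>Modulo \<open>a + b\<close> the level of vertex \<open>k\<close> is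
  \<open>b * k\<close>, and \<open>b\<close> is invertible there because it is coprime to
  \<open>a\<close>.\<close>

lemma lev_eq_mod_imp_eq:
  assumes "coprime a b" "i < a + b" "j < a + b"
    and dvd: "int (a + b) dvd lev a b W i - lev a b W j"
  shows "i = j"
proof -
  have "lev a b W k = int b * int k - int (a + b) * int (east W k)" for k
  proof -
    have "int k = int (east W k) + int (north W k)" by (simp add: east_add_north flip: of_nat_add)
    then show ?thesis by (simp add: lev_def level_def algebra_simps)
  qed
  then have "int b * (int i - int j)
      = lev a b W i - lev a b W j + int (a + b) * (int (east W i) - int (east W j))"
    by (simp add: algebra_simps)
  then have "int (a + b) dvd int b * (int i - int j)" using dvd by simp
  moreover have "coprime (a + b) b" using assms(1) by (simp add: coprime_iff_gcd_eq_1)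
  then have "coprime (int (a + b)) (int b)" by (simp only: coprime_int_iff)
  ultimately have "int (a + b) dvd int i - int j" by (simp only: coprime_dvd_mult_right_iff)
  then show ?thesis
    using assms(2,3) zdvd_imp_le[of "int (a + b)" "int i - int j"]
      zdvd_imp_le[of "int (a + b)" "int j - int i"] dvd_diff_commute[of "int (a + b)" "int i" "int j"]
    by (cases i j rule: linorder_cases) auto
qed

lemma hplus_eq_hminus:
  assumes "coprime a b"
  shows "hplus b a (partition_of (a + b) W) = hminus b a (partition_of (a + b) W)"
proof -
  have "lev a b W i - lev a b W j \<noteq> 0 \<and> lev a b W i - lev a b W j \<noteq> int (a + b)"
    if "(i, j) \<in> inversions (a + b) W" for i j
  proof -
    have "i < j" "j < a + b" using that by (auto simp: inversions_def)
    then show ?thesis using lev_eq_mod_imp_eq[OF assms, of i j W] by auto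
  qed
  then show ?thesis
    unfolding hplus_partition_of hminus_partition_of
    by (intro arg_cong[where f = card]) force
qed

section \<open>Weight and rank, and the invariance of their difference under shifts\<close>

definition pair_weight :: "nat \<Rightarrow> nat \<Rightarrow> (nat \<Rightarrow> bool) \<Rightarrow> nat \<Rightarrow> nat \<Rightarrow> int" where
  "pair_weight a b W i j = of_bool (\<not> W i \<and> W j) + of_bool (\<not> W i \<and> W j \<and>
     0 < lev a b W i - lev a b W j \<and> lev a b W i - lev a b W j \<le> int (a + b))"

text \<open>\<open>pair_weight\<close> does not require \<open>i < j\<close>, so it also makes sense
  for a pair whose order a shift reverses. The minimum is over the whole periodic sequence because a
  shift merely translates that set of levels.\<close>

definition weight :: "nat \<Rightarrow> nat \<Rightarrow> (nat \<Rightarrow> bool) \<Rightarrow> int" where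
  "weight a b W = (\<Sum>j<a + b. \<Sum>i<j. pair_weight a b W i j) + Min (range (lev a b W))"

definition rank :: "nat \<Rightarrow> nat \<Rightarrow> (nat \<Rightarrow> bool) \<Rightarrow> nat" where
  "rank a b W = (\<Sum>j<a + b. of_bool (lev a b W j < 0))"

lemma range_lev:
  assumes "W \<in> words a b" "a > 0"
  shows "range (lev a b W) = lev a b W ` {..a + b}"
proof
  show "range (lev a b W) \<subseteq> lev a b W ` {..a + b}"
  proof clarify
    fix i
    have "lev a b W i = lev a b W (i mod (a + b))" by (simp add: lev_mod[OF assms(1)])
    then show "lev a b W i \<in> lev a b W ` {..a + b}"
      using assms(2) by (auto simp: less_imp_le)
  qed
qed auto

lemma weight_partition_of:
  assumes "W \<in> words a b" "a > 0"
  shows "int (sum_list (partition_of (a + b) W)) + ml b a (partition_of (a + b) W)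
       + int (hplus b a (partition_of (a + b) W)) = weight a b W"
proof -
  have "card (inversions (a + b) W) = (\<Sum>j<a + b. \<Sum>i<j. of_bool (\<not> W i \<and> W j))"
    using card_inversions[of "a + b" W "\<lambda>i j. True"] by simp
  then show ?thesis
    unfolding weight_def pair_weight_def sum_list_partition_of hplus_partition_of
      card_inversions ml_partition_of[OF assms(1)] range_lev[OF assms]
    by (simp add: sum.distrib)
qed

text \<open>Shifting the triangle \<open>i < j < n\<close> exchanges its row \<open>i = 0\<close> for the column \<open>j = n\<close>, which
  periodicity identifies with the column \<open>j = 0\<close>.\<close>

lemma sum_triangle_shift:
  fixes g :: "nat \<Rightarrow> nat \<Rightarrow> int"
  assumes "n > 0" "\<And>i. g i n = g i 0" "g 0 0 = 0"
  shows "(\<Sum>j<n. \<Sum>i<j. g (Suc i) (Suc j)) - (\<Sum>j<n. \<Sum>i<j. g i j)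
       = (\<Sum>i<n. g i 0) - (\<Sum>i<n. g 0 i)"
proof -
  obtain m where m: "n = Suc m" using assms(1) by (cases n) auto
  have "(\<Sum>j<n. \<Sum>i<j. g i j) = (\<Sum>j<m. g 0 (Suc j) + (\<Sum>i<j. g (Suc i) (Suc j)))"
    unfolding m by (simp add: sum.lessThan_Suc_shift del: sum.lessThan_Suc)
  moreover have "(\<Sum>j<n. \<Sum>i<j. g (Suc i) (Suc j))
      = (\<Sum>j<m. \<Sum>i<j. g (Suc i) (Suc j)) + (\<Sum>i<m. g (Suc i) 0)"
    using assms(2) by (simp add: m)
  moreover have "(\<Sum>i<n. g i 0) = (\<Sum>i<m. g (Suc i) 0)" "(\<Sum>i<n. g 0 i) = (\<Sum>i<m. g 0 (Suc i))"
    unfolding m using assms(3) by (simp_all add: sum.lessThan_Suc_shift del: sum.lessThan_Suc)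
  ultimately show ?thesis by (simp add: sum.distrib)
qed

lemma sum_periodic_shift:
  fixes f :: "nat \<Rightarrow> 'a :: cancel_comm_monoid_add"
  assumes "\<And>i. f (i + n) = f i"
  shows "(\<Sum>j<n. f (j + k)) = (\<Sum>j<n. f j)"
proof (induction k)
  case (Suc k)
  have "f k + (\<Sum>j<n. f (j + Suc k)) = (\<Sum>j<Suc n. f (j + k))"
    by (subst sum.lessThan_Suc_shift) simp
  also have "\<dots> = f k + (\<Sum>j<n. f (j + k))"
    using assms[of k] by (simp add: add.commute)
  finally show ?case using Suc by simp
qed simp

lemma Min_range_lev_shift:
  assumes W: "W \<in> words a b" and a: "a > 0"
  shows "Min (range (lev a b (shift 1 W))) = Min (range (lev a b W)) - lev a b W 1"
proof -
  \<comment> \<open>The level of vertex \<open>i\<close> recurs one period later, which gives a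
    preimage under \<open>Suc\<close> even for \<open>i = 0\<close>.\<close>
  have "lev a b W i \<in> range (\<lambda>i. lev a b W (Suc i))" for i
    using lev_period[OF W, of i] a by (intro range_eqI[of _ _ "i + (a + b) - 1"]) simp
  then have "range (\<lambda>i. lev a b W (Suc i)) = range (lev a b W)" by auto
  moreover have "range (lev a b (shift 1 W))
      = (\<lambda>x. x + (- lev a b W 1)) ` range (\<lambda>i. lev a b W (Suc i))"
    by (simp add: lev_shift image_image)
  ultimately have "range (lev a b (shift 1 W))
      = (\<lambda>x. x + (- lev a b W 1)) ` range (lev a b W)" by simp
  moreover have "finite (range (lev a b W))" by (simp add: range_lev[OF W a])
  ultimately show ?thesis
    using Min_add_commute[of "range (lev a b W)" "\<lambda>x. x" "- lev a b W 1"] by simp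
qed

lemma sum_of_bool_east: "(\<Sum>i<n. of_bool (\<not> W i)) = int (east W n)"
  and sum_of_bool_north: "(\<Sum>i<n. of_bool (W i)) = int (north W n)"
  by (simp_all add: east_def north_def)

text \<open>Only pairs containing the moved step change. A north step at the front is in no
  inversion; at the end it is in one with each of the \<open>b\<close> east steps, and this gain of
  \<open>b\<close> cancels against the drop of the minimum by \<open>?L 1 = b\<close>. An east step
  dually loses \<open>a\<close> inversions while the minimum rises by \<open>a\<close>. What remains
  is the level condition on these pairs, whose count is the change of \<open>rank\<close>.\<close>

lemma weight_minus_rank_shift_1:
  assumes W: "W \<in> words a b" and a: "a > 0" and cop: "coprime a b"
  shows "weight a b (shift 1 W) - int (rank a b (shift 1 W)) = weight a b W - int (rank a b W)"
proof -
  let ?n = "a + b" and ?L = "lev a b W"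
  define g where "g = pair_weight a b W"
  have Wn: "W ?n = W 0" using words_mod[OF W, of ?n] by simp
  have Ln: "?L ?n = 0" using lev_period[OF W, of 0] by simp
  have "pair_weight a b (shift 1 W) i j = g (Suc i) (Suc j)" for i j
    by (simp add: g_def pair_weight_def lev_shift) (simp add: shift_def)
  moreover have "(\<Sum>j<?n. \<Sum>i<j. g (Suc i) (Suc j)) - (\<Sum>j<?n. \<Sum>i<j. g i j)
      = (\<Sum>i<?n. g i 0) - (\<Sum>i<?n. g 0 i)"
    by (rule sum_triangle_shift) (use a Wn Ln in \<open>auto simp: g_def pair_weight_def\<close>)
  ultimately have weight: "weight a b (shift 1 W) - weight a b W
      = (\<Sum>i<?n. g i 0) - (\<Sum>i<?n. g 0 i) - ?L 1"
    unfolding weight_def Min_range_lev_shift[OF W a] by (simp add: g_def)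
  have rank: "int (rank a b (shift 1 W)) - int (rank a b W)
      = (\<Sum>j<?n. of_bool (?L (Suc j) < ?L 1) - of_bool (?L j < 0))"
    by (simp add: rank_def lev_shift sum_subtractf)
  have ne: "?L j \<noteq> 0 \<and> ?L j \<noteq> int ?n" if "j < ?n" "j \<noteq> 0" for j
    using lev_eq_mod_imp_eq[OF cop that(1), of 0 W] that a by auto
  have L1: "?L 1 = (if W 0 then int b else - int a)"
    using lev_Suc[of a b W 0] by simp
  show ?thesis
  proof (cases "W 0")
    case True
    have "(\<Sum>i<?n. g i 0)
        = (\<Sum>i<?n. of_bool (\<not> W i) + of_bool (\<not> W i \<and> 0 < ?L i \<and> ?L i \<le> int ?n))"
      using True by (simp add: g_def pair_weight_def)
    also have "\<dots> = int b + (\<Sum>j<?n. of_bool (\<not> W j \<and> 0 < ?L j \<and> ?L j \<le> int ?n))"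
      using sum_of_bool_east[of W ?n] words_east[OF W] by (simp add: sum.distrib)
    also have "(\<Sum>j<?n. of_bool (\<not> W j \<and> 0 < ?L j \<and> ?L j \<le> int ?n))
        = (\<Sum>j<?n. of_bool (?L (Suc j) < ?L 1) - of_bool (?L j < 0) :: int)"
    proof (rule sum.cong[OF refl])
      \<comment> \<open>For an east step \<open>j\<close> the right-hand side tests \<open>0 \<le> L j < n\<close> instead of \<open>0 < L j \<le> n\<close>; the
        levels \<open>0\<close> and \<open>n\<close> cannot occur, as levels are distinct modulo \<open>n\<close>.\<close>
      fix j assume "j \<in> {..<?n}"
      then show "of_bool (\<not> W j \<and> 0 < ?L j \<and> ?L j \<le> int ?n)
          = (of_bool (?L (Suc j) < ?L 1) - of_bool (?L j < 0) :: int)"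
        using ne[of j] True L1 by (cases "j = 0") (auto simp: lev_Suc)
    qed
    finally have "(\<Sum>i<?n. g i 0)
        = int b + (int (rank a b (shift 1 W)) - int (rank a b W))" using rank by simp
    moreover have "(\<Sum>i<?n. g 0 i) = 0" using True by (simp add: g_def pair_weight_def)
    ultimately show ?thesis using weight L1 True by simp
  next
    case False
    have "(\<Sum>i<?n. g 0 i)
        = (\<Sum>i<?n. of_bool (W i) + of_bool (W i \<and> - int ?n \<le> ?L i \<and> ?L i < 0))"
      using False by (intro sum.cong) (auto simp: g_def pair_weight_def)
    also have "\<dots> = int a + (\<Sum>j<?n. of_bool (W j \<and> - int ?n \<le> ?L j \<and> ?L j < 0))"
      using sum_of_bool_north[of W ?n] words_north[OF W] by (simp add: sum.distrib)
    \<comment> \<open>As \<open>?L 1 = - a\<close>, for a north step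
      \<open>?L (Suc j) < ?L 1\<close> means \<open>?L j < - n\<close>; for an east step it means
      \<open>?L j < 0\<close>, and the two terms cancel.\<close>
    also have "(\<Sum>j<?n. of_bool (W j \<and> - int ?n \<le> ?L j \<and> ?L j < 0))
        = (\<Sum>j<?n. - (of_bool (?L (Suc j) < ?L 1) - of_bool (?L j < 0)) :: int)"
      using False L1 by (intro sum.cong) (auto simp: lev_Suc)
    also have "\<dots> = - (int (rank a b (shift 1 W)) - int (rank a b W))"
      by (simp only: rank sum_negf)
    finally have "(\<Sum>i<?n. g 0 i)
        = int a - (int (rank a b (shift 1 W)) - int (rank a b W))" by simp
    moreover have "(\<Sum>i<?n. g i 0) = 0" using False by (simp add: g_def pair_weight_def)
    ultimately show ?thesis using weight L1 False by simp
  qed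
qed

lemma weight_minus_rank_shift:
  assumes "W \<in> words a b" "a > 0" "coprime a b"
  shows "weight a b (shift k W) - int (rank a b (shift k W)) = weight a b W - int (rank a b W)"
proof (induction k)
  case (Suc k)
  then show ?case
    using weight_minus_rank_shift_1[OF shift_in_words[OF assms(1), of k] assms(2,3)]
    by (simp add: shift_shift)
qed (simp add: shift_def)

section \<open>Cyclic orbits: the values of the rank, and the unique Dyck word\<close>

lemma bij_betw_rank:
  fixes L :: "nat \<Rightarrow> 'a :: linorder"
  assumes "inj_on L {..<n}"
  shows "bij_betw (\<lambda>k. card {j \<in> {..<n}. L j < L k}) {..<n} {..<n}"
proof -
  let ?f = "\<lambda>k. card {j \<in> {..<n}. L j < L k}"
  have "?f k < n" if "k < n" for k
  proof -
    have "{j \<in> {..<n}. L j < L k} \<subset> {..<n}" using that by auto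
    from psubset_card_mono[OF _ this] show ?thesis by simp
  qed
  moreover have less: "?f k < ?f l" if "k < n" "L k < L l" for k l
    using that by (intro psubset_card_mono) auto
  have "inj_on ?f {..<n}"
  proof (rule inj_onI)
    fix k l assume "k \<in> {..<n}" "l \<in> {..<n}" "?f k = ?f l"
    then have "L k = L l" using less[of k l] less[of l k] by (cases "L k" "L l" rule: linorder_cases) auto
    then show "k = l" using assms \<open>k \<in> {..<n}\<close> \<open>l \<in> {..<n}\<close> by (simp add: inj_on_eq_iff)
  qed
  ultimately show ?thesis
    by (intro bij_betw_imageI endo_inj_surj) auto
qed

text \<open>After a shift by \<open>k\<close> the vertices of negative level are those that were
  lower than vertex \<open>k\<close>. So the rank is the position of that vertex when the distinct
  levels are sorted.\<close>

lemma sum_rank_shift: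
  fixes f :: "nat \<Rightarrow> 'c :: comm_monoid_add"
  assumes W: "W \<in> words a b" and cop: "coprime a b"
  shows "(\<Sum>k<a + b. f (rank a b (shift k W))) = (\<Sum>i<a + b. f i)"
proof -
  let ?n = "a + b"
  have "rank a b (shift k W) = card {j \<in> {..<?n}. lev a b W j < lev a b W k}" for k
  proof -
    have "rank a b (shift k W) = (\<Sum>j<?n. of_bool (lev a b W (j + k) < lev a b W k))"
      by (simp add: rank_def lev_shift)
    also have "\<dots> = (\<Sum>j<?n. of_bool (lev a b W j < lev a b W k))"
      by (rule sum_periodic_shift) (simp only: lev_period[OF W])
    finally show ?thesis by (simp add: sum_of_bool_eq lessThan_def Collect_conj_eq)
  qed
  moreover have "inj_on (lev a b W) {..<?n}"
    using lev_eq_mod_imp_eq[OF cop, of _ _ W] by (auto intro!: inj_onI)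
  ultimately show ?thesis using sum.reindex_bij_betw[OF bij_betw_rank] by simp
qed

definition dyck_words :: "nat \<Rightarrow> nat \<Rightarrow> (nat \<Rightarrow> bool) set" where
  "dyck_words a b = {W \<in> words a b. \<forall>i. 0 \<le> lev a b W i}"

text \<open>A form of the cycle lemma: a rotation has no negative level exactly when it starts at a
  vertex of minimal level, and there is one such vertex per period.\<close>

lemma bij_betw_shift_dyck_words:
  assumes a: "a > 0" and cop: "coprime a b"
  shows "bij_betw (\<lambda>(W, k). shift k W) (dyck_words a b \<times> {..<a + b}) (words a b)"
  unfolding bij_betw_def
proof
  let ?n = "a + b"
  show "inj_on (\<lambda>(W, k). shift k W) (dyck_words a b \<times> {..<?n})"
  proof (rule inj_onI, clarsimp simp del: add_gr_0)
    fix W W' k k'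
    assume dW: "W \<in> dyck_words a b" and dW': "W' \<in> dyck_words a b" and k: "k < ?n" "k' < ?n"
      and eq: "shift k W = shift k' W'"
    have W: "W \<in> words a b" and W': "W' \<in> words a b" using dW dW' by (auto simp: dyck_words_def)
    \<comment> \<open>The second summand completes the shift by \<open>k'\<close> to a full period,
      hence undoes it.\<close>
    define m where "m = k + (?n - k')"
    have "shift (?n - k') (shift k' W') = W'"
      using shift_eq_self[OF W', of ?n] k by (simp add: shift_shift)
    then have W'_eq: "W' = shift m W"
      by (simp add: eq[symmetric] shift_shift m_def add.commute)
    \<comment> \<open>Since \<open>W'\<close> starts at vertex \<open>m\<close> of \<open>W\<close>,
      that vertex has minimal level. The multiple \<open>?n * m\<close> of the period is a later
      vertex of level 0 to compare it with.\<close>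
    have "lev a b W m \<le> lev a b W (?n * m)"
    proof -
      have "0 \<le> lev a b W' (?n * m - m)" using dW' by (simp add: dyck_words_def)
      moreover have "m \<le> ?n * m" using a by simp
      ultimately show ?thesis by (simp add: W'_eq lev_shift)
    qed
    also have "\<dots> = 0" using lev_mod[OF W, of "?n * m"] by simp
    finally have "lev a b W (m mod ?n) = 0"
      using dW by (simp add: lev_mod[OF W] dyck_words_def order_antisym)
    then have m: "m mod ?n = 0"
      using lev_eq_mod_imp_eq[OF cop, of "m mod ?n" 0 W] a by simp
    then have "?n dvd m" by auto
    then obtain t where t: "m = ?n * t" ..
    \<comment> \<open>The only multiple of \<open>?n\<close> strictly between \<open>0\<close> and
      \<open>?n * 2\<close> is \<open>?n\<close>, which means \<open>k = k'\<close>.\<close>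
    have "0 < m" "m < ?n * 2" using k by (auto simp: m_def)
    then have "0 < ?n * t" "?n * t < ?n * 2" by (simp_all only: t)
    then have "t = 1" by (simp only: mult_less_cancel1 zero_less_mult_iff) simp
    then have "k = k'" using k t by (simp add: m_def)
    moreover have "W = W'" using shift_eq_self[OF W m] W'_eq by simp
    ultimately show "W = W' \<and> k = k'" by simp
  qed
  show "(\<lambda>(W, k). shift k W) ` (dyck_words a b \<times> {..<?n}) = words a b"
  proof
    show "(\<lambda>(W, k). shift k W) ` (dyck_words a b \<times> {..<?n}) \<subseteq> words a b"
      by (auto simp: dyck_words_def intro: shift_in_words)
    show "words a b \<subseteq> (\<lambda>(W, k). shift k W) ` (dyck_words a b \<times> {..<?n})"
    proof
      fix V assume V: "V \<in> words a b"
      have fin: "finite (range (lev a b V))" by (simp add: range_lev[OF V a])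
      obtain m where m: "lev a b V m = Min (range (lev a b V))"
        using Min_in[OF fin] by auto
      have "lev a b V m \<le> lev a b V i" for i using Min_le[OF fin] m by simp
      then have dyck: "shift m V \<in> dyck_words a b"
        using shift_in_words[OF V] by (auto simp: dyck_words_def lev_shift)
      \<comment> \<open>\<open>?n * m - m\<close> represents \<open>- m\<close> modulo the period
        within the natural numbers.\<close>
      define k where "k = (?n * m - m) mod ?n"
      have "m \<le> ?n * m" using a by simp
      then have "(k + m) mod ?n = 0" by (simp add: k_def mod_add_left_eq)
      then have "V = shift k (shift m V)" using shift_eq_self[OF V] by (simp add: shift_shift)
      moreover have "k < ?n" using a by (simp add: k_def)
      ultimately show "V \<in> (\<lambda>(W, k). shift k W) ` (dyck_words a b \<times> {..<?n})"
        using dyck by (auto simp: image_iff intro!: bexI[of _ "(shift m V, k)"])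
    qed
  qed
qed

section \<open>Generating functions\<close>

lemma qvar_nonzero: "qvar \<noteq> 0"
  by (simp add: qvar_def Zero_fract_def eq_fract)

lemma qint_nonzero:
  assumes "n > 0"
  shows "qint n \<noteq> 0"
proof
  have Fract_power: "qvar ^ i = Fraction_Field.Fract ([:0, 1:] ^ i) 1" for i
    by (induction i) (auto simp: qvar_def One_fract_def)
  have "qint n = Fraction_Field.Fract (\<Sum>i<n. [:0, 1:] ^ i) 1"
    unfolding qint_def Fract_power by (induction n) (auto simp: Zero_fract_def)
  moreover assume "qint n = 0"
  ultimately have "(\<Sum>i<n. [:0, 1:] ^ i) = (0 :: rat poly)"
    by (simp add: Zero_fract_def eq_fract)
  \<comment> \<open>Evaluation at 1 gives \<open>n\<close>, which is nonzero in the
    rationals.\<close>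
  then have "poly (\<Sum>i<n. [:0, 1:] ^ i) 1 = (0 :: rat)" by simp
  then show False using assms by (simp add: poly_sum)
qed

lemma sum_box_partitions:
  assumes a: "a > 0" and cop: "coprime a b"
  shows "(\<Sum>\<mu>\<in>box_partitions a b. qvar powi (int (sum_list \<mu>) + ml b a \<mu> + int (hplus b a \<mu>)))
       = qint (a + b) * (\<Sum>\<mu>\<in>triangle_partitions a b. qvar ^ (sum_list \<mu> + hplus b a \<mu>))"
proof -
  let ?n = "a + b"
  let ?p = "partition_of ?n"
  have dyck: "dyck_words a b \<subseteq> words a b" by (auto simp: dyck_words_def)
  have bij: "bij_betw ?p (words a b) (box_partitions a b)" by (rule bij_betw_partition_of[OF a])
  have "?p ` dyck_words a b = triangle_partitions a b"
  proof -
    have "triangle_partitions a b \<subseteq> ?p ` words a b"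
      using bij by (auto simp: bij_betw_def triangle_partitions_def)
    then show ?thesis using partition_of_triangle_iff[OF _ a, of _ b] by (auto simp: dyck_words_def)
  qed
  then have bij_dyck: "bij_betw ?p (dyck_words a b) (triangle_partitions a b)"
    using bij dyck by (metis bij_betw_imp_inj_on bij_betw_def inj_on_subset)
  \<comment> \<open>A Dyck word starts at level 0 and never goes below it, so its \<open>ml\<close>
    and its rank both vanish. The shift invariant is thus the exponent of the triangle sum, and all
    exponents of the orbit are nonnegative.\<close>
  have weight_dyck: "weight a b (shift k W)
      = int (sum_list (?p W) + hplus b a (?p W)) + int (rank a b (shift k W))"
    if W: "W \<in> dyck_words a b" for W k
  proof -
    have "0 \<in> range (lev a b W)" by (metis lev_0 rangeI)
    then have "Min (range (lev a b W)) = 0"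
      using W dyck range_lev[OF _ a, of W b] by (intro Min_eqI) (auto simp: dyck_words_def)
    then have "ml b a (?p W) = 0"
      using W dyck range_lev[OF _ a, of W b] ml_partition_of[of W a b] by auto
    then have "weight a b W = int (sum_list (?p W) + hplus b a (?p W))"
      using weight_partition_of[OF _ a, of W b] W dyck by auto
    moreover have "rank a b W = 0" using W by (simp add: rank_def dyck_words_def not_less[symmetric])
    ultimately show ?thesis
      using weight_minus_rank_shift[OF _ a cop, of W k] W dyck by auto
  qed
  have "(\<Sum>\<mu>\<in>box_partitions a b. qvar powi (int (sum_list \<mu>) + ml b a \<mu> + int (hplus b a \<mu>)))
      = (\<Sum>W\<in>words a b. qvar powi weight a b W)"
    by (subst sum.reindex_bij_betw[OF bij, symmetric], rule sum.cong)
      (auto simp: weight_partition_of a)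
  also have "\<dots> = (\<Sum>(W, k)\<in>dyck_words a b \<times> {..<?n}. qvar powi weight a b (shift k W))"
    by (subst sum.reindex_bij_betw[OF bij_betw_shift_dyck_words[OF a cop], symmetric])
      (simp add: case_prod_unfold)
  also have "\<dots> = (\<Sum>W\<in>dyck_words a b. \<Sum>k<?n. qvar powi weight a b (shift k W))"
    by (rule sum.cartesian_product[symmetric])
  also have "\<dots> = (\<Sum>W\<in>dyck_words a b. \<Sum>k<?n.
      qvar ^ (sum_list (?p W) + hplus b a (?p W)) * qvar ^ rank a b (shift k W))"
    by (intro sum.cong refl)
      (simp add: weight_dyck power_int_add qvar_nonzero power_add del: of_nat_add)
  \<comment> \<open>Over one orbit the rank takes each value below \<open>?n\<close> once, so the
    inner sum of its powers is \<open>qint ?n\<close>.\<close>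
  also have "\<dots> = (\<Sum>W\<in>dyck_words a b. qvar ^ (sum_list (?p W) + hplus b a (?p W)) * qint ?n)"
    using dyck sum_rank_shift[OF _ cop, of _ "\<lambda>i. qvar ^ i"]
    by (intro sum.cong) (auto simp: qint_def sum_distrib_left[symmetric])
  also have "\<dots> = qint ?n * (\<Sum>\<mu>\<in>triangle_partitions a b. qvar ^ (sum_list \<mu> + hplus b a \<mu>))"
    by (subst sum.reindex_bij_betw[OF bij_dyck, symmetric])
      (simp add: sum_distrib_left mult.commute)
  finally show ?thesis .
qed

theorem theorem10:
  fixes a b :: nat
  assumes "a > 0" and "b > 0" and "coprime a b"
  shows "1 / qint (a + b) * qbinom a b
           = (\<Sum>\<mu>\<in>triangle_partitions a b. qvar ^ (sum_list \<mu> + hplus b a \<mu>))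
     \<longleftrightarrow>
     (qbinom a b
           = (\<Sum>\<mu>\<in>box_partitions a b. qvar powi (int (sum_list \<mu>) + ml b a \<mu> + int (hplus b a \<mu>)))
      \<and> (\<Sum>\<mu>\<in>box_partitions a b. qvar powi (int (sum_list \<mu>) + ml b a \<mu> + int (hplus b a \<mu>)))
           = (\<Sum>\<mu>\<in>box_partitions a b. qvar powi (int (sum_list \<mu>) + ml b a \<mu> + int (hminus b a \<mu>))))"
proof -
  have "hplus b a \<mu> = hminus b a \<mu>" if "\<mu> \<in> box_partitions a b" for \<mu>
  proof -
    have "\<mu> \<in> partition_of (a + b) ` words a b"
      using that bij_betw_partition_of[OF assms(1), of b] by (simp add: bij_betw_def)
    then obtain W where "\<mu> = partition_of (a + b) W" by (rule imageE)
    then show ?thesis by (simp only: hplus_eq_hminus[OF assms(3)])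
  qed
  then have "(\<Sum>\<mu>\<in>box_partitions a b. qvar powi (int (sum_list \<mu>) + ml b a \<mu> + int (hplus b a \<mu>)))
      = (\<Sum>\<mu>\<in>box_partitions a b. qvar powi (int (sum_list \<mu>) + ml b a \<mu> + int (hminus b a \<mu>)))"
    by (intro sum.cong) simp_all
  moreover have "qint (a + b) \<noteq> 0" using assms(1) by (simp add: qint_nonzero)
  ultimately show ?thesis
    unfolding sum_box_partitions[OF assms(1,3)] by (simp add: nonzero_divide_eq_eq mult.commute)
qed

end
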